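(* Let $\mathcal{H}$ be a real Hilbert space and let $\mu\in\left]0,\infty\right[$. Assume that $A\colon\mathcal{H}\rightrightarrows\mathcal{H}$ and $B\colon\mathcal{H}\rightrightarrows\mathcal{H}$ are maximal monotone, that $C\colon\mathcal{H}\to\mathcal{H}$ is (single-valued) monotone and $\mu$-Lipschitz continuous, and that $\operatorname{zer}(A+B+C)\neq\varnothing$. Let $\gamma>0$, let $z_0\in\mathcal{H}$ be arbitrary, and for $n=0,1,\dots$ define \[ \begin{cases} x_{n+1}= J_{\gamma B}z_n\\ y_{n+1}= J_{\gamma A}(2x_{n+1}- z_n -\gamma Cx_{n+1})\\ z_{n+1}= z_n+y_{n+1}-x_{n+1}-\gamma (Cy_{n+1}-Cx_{n+1}). \end{cases} \] Suppose that one of the following conditions holds: (i) $B$ is (single-valued and) $\kappa$-cocoercive for some $\kappa\in\left]0,\infty\right[$, and $0<\gamma<\mu^{-1}/\sqrt{1+\gamma/(2\kappa)}$ (which is satisfied, for example, if $0<\gamma<\min\{\kappa,\mu^{-1}\sqrt{2/3}\}$); (ii) $B=N_V$ and $C=P_VC_1P_V$ for some closed vector subspace $V\subseteq\mathcal{H}$ and some single-valued operator $C_1\colon\mathcal{H}\to\mathcal{H}$, and $\gamma\in\left]0,1/\mu\right[$. Then there exists $z_\star\in\operatorname{Fix}(T)$ such that $z_n\rightharpoonup z_\star$, $x_n\rightharpoonup J_{\gamma B}z_\star\in\operatorname{zer}(A+B+C)$, and $y_n\rightharpoonup J_{\gamma B}z_\star$, where \[ T:= (\mathrm{Id}-\gamma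 C) J_{\gamma A}(2J_{\gamma B} -\mathrm{Id}- \gamma C J_{\gamma B}) +\mathrm{Id} - (\mathrm{Id}-\gamma C) J_{\gamma B}. \]
   Context: For a set-valued operator $M\colon\mathcal{H}\rightrightarrows\mathcal{H}$, $\operatorname{zer}(M)=\{x\in\mathcal{H}: 0\in Mx\}$, and $J_M=(\mathrm{Id}+M)^{-1}$ is its resolvent, which is single-valued with domain $\mathcal{H}$ when $M$ is maximal monotone. $\operatorname{Fix}(T)=\{x\in\mathcal{H}: Tx=x\}$. A single-valued operator $B\colon\mathcal{H}\to\mathcal{H}$ is $\kappa$-cocoercive if $\langle x-y, Bx-By\rangle\ge\kappa\|Bx-By\|^2$ for all $x,y\in\mathcal{H}$. $N_V$ is the normal cone operator of the closed subspace $V$, i.e. $N_V(x)=\{y\in\mathcal{H}:\langle y,z-x\rangle\le 0\ \forall z\in V\}$ for $x\in V$ and $N_V(x)=\varnothing$ for $x\notin V$. $P_V$ is the orthogonal projection onto $V$. The symbol $\rightharpoonup$ denotes weak convergence in $\mathcal{H}$. *)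

theory Defs
  imports "HOL-Analysis.Analysis"
begin

text \<open>
  A set-valued operator on a space is a function of type \<open>'a \<Rightarrow> 'a set\<close>; its domain is the set of
  points with nonempty value.  Real Hilbert spaces are the types of sort
  \<open>{real_inner, complete_space}\<close>.
\<close>

definition single_op :: "('a \<Rightarrow> 'b) \<Rightarrow> 'a \<Rightarrow> 'b set" where
  "single_op f = (\<lambda>x. {f x})"

definition op_plus :: "('a \<Rightarrow> 'b::plus set) \<Rightarrow> ('a \<Rightarrow> 'b set) \<Rightarrow> 'a \<Rightarrow> 'b set" where
  "op_plus M N = (\<lambda>x. {u + v | u v. u \<in> M x \<and> v \<in> N x})"

definition op_scale :: "real \<Rightarrow> ('a \<Rightarrow> 'b::scaleR set) \<Rightarrow> 'a \<Rightarrow> 'b set" where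
  "op_scale c M = (\<lambda>x. {c *\<^sub>R u | u. u \<in> M x})"

definition op_inverse :: "('a \<Rightarrow> 'b set) \<Rightarrow> 'b \<Rightarrow> 'a set" where
  "op_inverse M = (\<lambda>u. {x. u \<in> M x})"

definition zer :: "('a \<Rightarrow> 'b::zero set) \<Rightarrow> 'a set" where
  "zer M = {x. 0 \<in> M x}"

definition Fix :: "('a \<Rightarrow> 'a) \<Rightarrow> 'a set" where
  "Fix T = {x. T x = x}"

definition monotone_op :: "('a::real_inner \<Rightarrow> 'a set) \<Rightarrow> bool" where
  "monotone_op M \<longleftrightarrow> (\<forall>x y. \<forall>u\<in>M x. \<forall>v\<in>M y. 0 \<le> inner (x - y) (u - v))"

definition maximal_monotone :: "('a::real_inner \<Rightarrow> 'a set) \<Rightarrow> bool" where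
  "maximal_monotone M \<longleftrightarrow>
     monotone_op M \<and> (\<forall>M'. monotone_op M' \<and> (\<forall>x. M x \<subseteq> M' x) \<longrightarrow> M' = M)"

definition cocoercive :: "real \<Rightarrow> ('a::real_inner \<Rightarrow> 'a) \<Rightarrow> bool" where
  "cocoercive \<kappa> f \<longleftrightarrow> (\<forall>x y. inner (x - y) (f x - f y) \<ge> \<kappa> * (norm (f x - f y))\<^sup>2)"

text \<open>
  The resolvent as a function: \<open>the_elem\<close> picks the unique element of \<open>(Id + M)\<^sup>-\<^sup>1 x\<close>.  It is
  meaningful only where that set is a singleton, hence everywhere for maximal monotone \<open>M\<close>.
\<close>

definition resolvent :: "('a::real_inner \<Rightarrow> 'a set) \<Rightarrow> 'a \<Rightarrow> 'a" where
  "resolvent M x = the_elem (op_inverse (op_plus (single_op id) M) x)"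

definition normal_cone :: "'a::real_inner set \<Rightarrow> 'a \<Rightarrow> 'a set" where
  "normal_cone V x = (if x \<in> V then {y. \<forall>z\<in>V. inner y (z - x) \<le> 0} else {})"

text \<open>
  The library's \<open>closest_point\<close> is restricted to \<open>heine_borel\<close> types, that is, to finite
  dimension.  The projection below is well defined for closed subspaces of a Hilbert space.
\<close>

definition orth_proj :: "'a::real_inner set \<Rightarrow> 'a \<Rightarrow> 'a" where
  "orth_proj V x = (THE p. p \<in> V \<and> (\<forall>v\<in>V. orthogonal (x - p) v))"

text \<open>
  Convergence in the coarsest topology making every \<open>\<lambda>x. inner x u\<close> continuous; in a Hilbert
  space these are all the continuous linear functionals.
\<close>

definition weakly_tendsto :: "(nat \<Rightarrow> 'a::real_inner) \<Rightarrow> 'a \<Rightarrow> bool" where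
  "weakly_tendsto s l \<longleftrightarrow> (\<forall>u. (\<lambda>n. inner (s n) u) \<longlonglongrightarrow> inner l u)"

definition splitting_op ::
    "real \<Rightarrow> ('a::real_inner \<Rightarrow> 'a set) \<Rightarrow> ('a \<Rightarrow> 'a set) \<Rightarrow> ('a \<Rightarrow> 'a) \<Rightarrow> 'a \<Rightarrow> 'a" where
  "splitting_op \<gamma> A B C =
     (let JA = resolvent (op_scale \<gamma> A);
          JB = resolvent (op_scale \<gamma> B);
          F = (\<lambda>w. w - \<gamma> *\<^sub>R C w)
      in (\<lambda>z. F (JA (2 *\<^sub>R JB z - z - \<gamma> *\<^sub>R C (JB z))) + z - F (JB z)))"

end

(*
  The iteration is z (n+1) = T (z n), and every solution q = p + \<gamma> b with b in B p and
  -b - C p in A p satisfies the Fejer estimate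
    |z (n+1) - q|^2 <= |z n - q|^2 - \<epsilon> |x (n+1) - y (n+1)|^2.
  Expanding the square leaves one term of unknown sign, the pairing of C y - C x with the
  difference of two elements of B: it is absorbed by cocoercivity in case (i) and vanishes by
  orthogonality in case (ii).  Hence x n - y n tends to 0.  For weak cluster points, adding the
  monotonicity inequalities of \<gamma> B and \<gamma> (A + C) turns the non-convergent products into products of a
  null and a bounded sequence; maximality then shows that cluster points are solutions, and
  Opial's argument gives weak convergence.

  The Hilbert space tools behind this (Minty's theorem, Riesz representation on closed
  subspaces, orthogonal projection, weak sequential compactness) all come from one
  minimization principle: |p|^2 + s over a convex set of pairs (p, s), where the parallelogram
  identity makes minimizing sequences Cauchy.
*)
theory Submission
  imports Defs "HOL-Library.Diagonal_Subsequence"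
begin

section \<open>Quadratic minimization over convex sets\<close>

text \<open>Along a segment \<open>|p|^2 + s\<close> is strongly convex in \<open>p\<close>, so
  almost minimal pairs have close first components, and these converge to some \<open>x\<close>. The
  conclusion is first-order optimality of \<open>x\<close> in the direction of
  \<open>(p, s)\<close>. The infimum may fail to be attained in \<open>S\<close>, so
  \<open>x\<close> is only placed in the closure.\<close>

lemma regularized_minimization:
  fixes S :: "('a::{real_inner, complete_space} \<times> real) set"
  assumes "convex S" "S \<noteq> {}"
    and lower: "\<And>p s. (p, s) \<in> S \<Longrightarrow> m \<le> (norm p)\<^sup>2 + s"
  obtains x where "x \<in> closure (fst ` S)"
    "\<And>p s. (p, s) \<in> S \<Longrightarrow> m + (norm x)\<^sup>2 \<le> 2 * inner x p + s"
proof -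
  define g where "g = (\<lambda>e::'a \<times> real. (norm (fst e))\<^sup>2 + snd e)"
  define d where "d = Inf (g ` S)"
  have bdd: "bdd_below (g ` S)"
    by (rule bdd_belowI[of _ m]) (auto simp: g_def dest: lower)
  have ne: "g ` S \<noteq> {}" using assms(2) by simp
  have dle: "d \<le> g e" if "e \<in> S" for e
    unfolding d_def using that bdd by (auto intro: cInf_lower)
  have md: "m \<le> d"
    unfolding d_def using ne by (rule cInf_greatest) (auto simp: g_def dest: lower)
  have "\<exists>e\<in>S. g e < d + inverse (real (Suc n))" for n
    using cInf_lessD[OF ne, of "d + inverse (real (Suc n))"] unfolding d_def by auto
  then obtain e where eS: "\<And>n. e n \<in> S" and eg: "\<And>n. g (e n) < d + inverse (real (Suc n))"
    by metis
  define p where "p = (\<lambda>n. fst (e n))"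
  have glim: "(\<lambda>n. g (e n)) \<longlonglongrightarrow> d"
  proof (rule tendsto_sandwich[of "\<lambda>_. d"])
    show "(\<lambda>n. d + inverse (real (Suc n))) \<longlonglongrightarrow> d"
      using tendsto_add[OF tendsto_const LIMSEQ_inverse_real_of_nat, of d] by simp
  qed (auto intro!: always_eventually less_imp_le dle eS eg simp del: of_nat_Suc)
  have seg: "(1 - t) *\<^sub>R a + t *\<^sub>R b \<in> S" if "a \<in> S" "b \<in> S" "0 \<le> t" "t \<le> 1" for a b t
    using \<open>convex S\<close> that by (auto simp: convex_alt)
  have gseg: "g ((1 - t) *\<^sub>R a + t *\<^sub>R b)
      = (1 - t) * g a + t * g b - t * (1 - t) * (norm (fst a - fst b))\<^sup>2" for a b t
    unfolding g_def power2_norm_eq_inner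
    by (simp add: inner_simps algebra_simps inner_commute)
  \<comment> \<open>At the midpoint, \<open>d\<close> is at most the mean of the two values minus a
    quarter of the squared distance.\<close>
  have par: "(norm (p i - p j))\<^sup>2 \<le> 2 * (inverse (real (Suc i)) + inverse (real (Suc j)))" for i j
    using dle[OF seg[OF eS[of i] eS[of j], of "1/2"]] eg[of i] eg[of j]
    unfolding gseg p_def by simp
  have "Cauchy p"
  proof (rule metric_CauchyI)
    fix \<epsilon> :: real assume "0 < \<epsilon>"
    then obtain N where N: "inverse (real (Suc N)) < \<epsilon>\<^sup>2 / 4"
      using reals_Archimedean[of "\<epsilon>\<^sup>2 / 4"] by auto
    have "dist (p i) (p j) < \<epsilon>" if "i \<ge> N" "j \<ge> N" for i j
    proof -
      have "inverse (real (Suc i)) \<le> inverse (real (Suc N))"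
        "inverse (real (Suc j)) \<le> inverse (real (Suc N))"
        using that by (auto intro!: le_imp_inverse_le)
      with par[of i j] N have "(norm (p i - p j))\<^sup>2 < \<epsilon>\<^sup>2" by argo
      then show ?thesis
        using \<open>0 < \<epsilon>\<close> by (auto simp: dist_norm intro: power2_less_imp_less)
    qed
    then show "\<exists>M. \<forall>i\<ge>M. \<forall>j\<ge>M. dist (p i) (p j) < \<epsilon>" by blast
  qed
  then obtain x where x: "p \<longlonglongrightarrow> x"
    using Cauchy_convergent convergentD by blast
  show thesis
  proof (rule that)
    show "x \<in> closure (fst ` S)"
      using x eS unfolding closure_sequential by (intro exI[of _ p]) (simp add: p_def)
  next
    fix q s assume qs: "(q, s) \<in> S"
    define K where "K = g (q, s) - (norm (x - q))\<^sup>2 - d"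
    \<comment> \<open>No minimizer in \<open>S\<close> is at hand, so the comparison with
      \<open>(q, s)\<close> starts from \<open>e n\<close> and passes to the limit in
      \<open>n\<close> for fixed \<open>t\<close>. Dividing by \<open>t\<close> comes before letting
      \<open>t\<close> tend to 0.\<close>
    have ineq: "0 \<le> K + t * (norm (x - q))\<^sup>2" if t: "0 < t" "t < 1" for t
    proof -
      have "(\<lambda>n. (1 - t) * g (e n) + t * g (q, s) - t * (1 - t) * (norm (p n - q))\<^sup>2)
          \<longlonglongrightarrow> (1 - t) * d + t * g (q, s) - t * (1 - t) * (norm (x - q))\<^sup>2"
        by (intro tendsto_intros glim x)
      moreover have "d \<le> (1 - t) * g (e n) + t * g (q, s) - t * (1 - t) * (norm (p n - q))\<^sup>2" for n
        using dle[OF seg[OF eS[of n] qs, of t]] t unfolding gseg p_def by simp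
      ultimately have "d \<le> (1 - t) * d + t * g (q, s) - t * (1 - t) * (norm (x - q))\<^sup>2"
        by (intro LIMSEQ_le_const) auto
      then have "0 \<le> t * (K + t * (norm (x - q))\<^sup>2)"
        unfolding K_def by (simp add: algebra_simps)
      then show ?thesis using t by (simp add: zero_le_mult_iff)
    qed
    have "0 \<le> K"
    proof (rule tendsto_lowerbound)
      show "((\<lambda>t. K + t * (norm (x - q))\<^sup>2) \<longlongrightarrow> K) (at_right 0)"
        by (auto intro!: tendsto_eq_intros)
      show "\<forall>\<^sub>F t in at_right 0. 0 \<le> K + t * (norm (x - q))\<^sup>2"
        using eventually_at_right_less[of 0] eventually_at_right[of 0 1]
        by (auto simp: eventually_at_right[of 0 1] intro!: exI[of _ 1] ineq)
    qed simp
    moreover have "(norm (x - q))\<^sup>2 = (norm x)\<^sup>2 - 2 * inner x q + (norm q)\<^sup>2"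
      by (simp add: power2_norm_eq_inner inner_simps inner_commute)
    ultimately show "m + (norm x)\<^sup>2 \<le> 2 * inner x q + s"
      using md unfolding K_def g_def by simp
  qed
qed

text \<open>
  The inequality says that \<open>x\<close> lies in all balls with centre \<open>(a + w - b) / 2\<close> and radius
  \<open>\<parallel>a + b - w\<parallel> / 2\<close> (Kirszbraun).  On convex combinations \<open>(p, q, s)\<close> of the triples
  \<open>(a, b - w, \<langle>a, b - w\<rangle>)\<close> monotonicity gives \<open>\<langle>p, q\<rangle> \<le> s\<close>, so the dual objective
  \<open>\<parallel>(p - q) / 2\<parallel>\<^sup>2 + s\<close> is nonnegative; its minimizer is the required \<open>x\<close>.
\<close>

lemma monotone_extension:
  fixes G :: "('a::{real_inner, complete_space} \<times> 'a) set"
  assumes mono: "\<And>a b a' b'. (a, b) \<in> G \<Longrightarrow> (a', b') \<in> G \<Longrightarrow> 0 \<le> inner (a - a') (b - b')"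
  shows "\<exists>x. \<forall>(a, b)\<in>G. 0 \<le> inner (x - a) (w - x - b)"
proof (cases "G = {}")
  case False
  define G' where "G' = (\<lambda>(a, b). (a, b - w, inner a (b - w))) ` G"
  define f :: "'a \<times> 'a \<times> real \<Rightarrow> 'a \<times> real" where
    "f = (\<lambda>(p, q, s). ((1/2) *\<^sub>R (p - q), s))"
  have "linear f"
    unfolding f_def by (rule linearI) (auto simp: algebra_simps)
  \<comment> \<open>The inequality is affine in each triple separately. Monotonicity gives it for
    two generators, and it extends to the hull one triple at a time. Two equal triples give twice
    \<open><p, q> \<le> s\<close>.\<close>
  have pair: "inner p q' + inner p' q \<le> s + s'"
    if 1: "(p, q, s) \<in> convex hull G'" and 2: "(p', q', s') \<in> convex hull G'" for p q s p' q' s'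
  proof -
    have convex: "convex {(p, q, s). inner p q' + inner p' q \<le> s + s'}" for p' q' :: 'a and s' :: real
    proof -
      have "(1 - t) * (inner p q' + inner p' q) + t * (inner r q' + inner p' v)
          \<le> (1 - t) * (s + s') + t * (k + s')"
        if "inner p q' + inner p' q \<le> s + s'" "inner r q' + inner p' v \<le> k + s'" "0 \<le> t" "t \<le> 1"
        for p q r v s k t
        using that by (intro add_mono[OF mult_left_mono mult_left_mono]) auto
      then show ?thesis
        by (fastforce simp: convex_alt inner_simps algebra_simps)
    qed
    have base: "inner p b + inner a q \<le> s + inner a b"
      if g: "(a, b, inner a b) \<in> G'" and "(p, q, s) \<in> convex hull G'" for a b p q s
    proof -
      have "inner p' b + inner a q' \<le> s' + inner a b" if "(p', q', s') \<in> G'" for p' q' s'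
      proof -
        have "(a, b + w) \<in> G" "(p', q' + w) \<in> G" and s': "s' = inner p' q'"
          using that g unfolding G'_def by auto
        from mono[OF this(1,2)] have "0 \<le> inner (a - p') (b - q')" by simp
        with s'
        show ?thesis by (simp add: inner_simps inner_commute)
      qed
      then have "G' \<subseteq> {(p, q, s). inner p b + inner a q \<le> s + inner a b}" by auto
      from hull_minimal[of _ _ convex, OF this convex] that(2) show ?thesis by auto
    qed
    have "G' \<subseteq> {(p', q', s'). inner p' q + inner p q' \<le> s' + s}"
    proof clarify
      fix a b k assume k: "(a, b, k) \<in> G'"
      then have "k = inner a b" by (auto simp: G'_def)
      with base[OF _ 1, of a b] k show "inner a q + inner p b \<le> k + s" by simp
    qed
    from hull_minimal[of _ _ convex, OF this convex] 2 show ?thesis by auto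
  qed
  define S where "S = f ` (convex hull G')"
  have "convex S" unfolding S_def by (intro convex_linear_image \<open>linear f\<close> convex_convex_hull)
  moreover have "S \<noteq> {}" using False by (auto simp: S_def G'_def)
  moreover have "0 \<le> (norm r)\<^sup>2 + s" if rs: "(r, s) \<in> S" for r s
  proof -
    obtain p q where pq: "(p, q, s) \<in> convex hull G'" "r = (1/2) *\<^sub>R (p - q)"
      using rs unfolding S_def f_def by auto
    have "(norm r)\<^sup>2 + inner p q = (norm ((1/2) *\<^sub>R (p + q)))\<^sup>2"
      unfolding pq(2) power2_norm_eq_inner by (simp add: inner_simps inner_commute field_simps)
    moreover have "inner p q \<le> s" using pair[OF pq(1) pq(1)] by simp
    ultimately show ?thesis using zero_le_power2[of "norm ((1/2) *\<^sub>R (p + q))"] by linarith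
  qed
  ultimately obtain x where x: "\<And>p s. (p, s) \<in> S \<Longrightarrow> 0 + (norm x)\<^sup>2 \<le> 2 * inner x p + s"
    using regularized_minimization[of S 0] by metis
  have "0 \<le> inner (x - a) (w - x - b)" if "(a, b) \<in> G" for a b
  proof -
    have "(a, b - w, inner a (b - w)) \<in> convex hull G'"
      using that by (auto simp: G'_def intro!: hull_inc)
    then have "((1/2) *\<^sub>R (a - (b - w)), inner a (b - w)) \<in> S"
      unfolding S_def f_def by force
    \<comment> \<open>At a generator the optimality inequality reads
      \<open>|x|^2 \<le> <x, a + w - b> + <a, b - w>\<close>, which is the claim with the product
      expanded.\<close>
    from x[OF this] show ?thesis
      by (simp add: power2_norm_eq_inner inner_simps inner_commute field_simps)
  qed
  then show ?thesis by blast
qed simp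

section \<open>Linear functionals and projection on closed subspaces\<close>

text \<open>Minimizing \<open>|u|^2 - 2 L u\<close> over \<open>U\<close> produces the representing
  vector; the bound \<open>K\<close> keeps this functional above \<open>-K^2\<close>. Linearity is
  asked for on \<open>U\<close> only, because the functional used later is a limit that is
  meaningful only there.\<close>

lemma Riesz_closed_subspace:
  fixes U :: "'a::{real_inner, complete_space} set" and L :: "'a \<Rightarrow> real"
  assumes U: "subspace U" "closed U"
    and add: "\<And>u v. u \<in> U \<Longrightarrow> v \<in> U \<Longrightarrow> L (u + v) = L u + L v"
    and scale: "\<And>c u. u \<in> U \<Longrightarrow> L (c *\<^sub>R u) = c * L u"
    and bound: "\<And>u. u \<in> U \<Longrightarrow> \<bar>L u\<bar> \<le> K * norm u"
  shows "\<exists>x\<in>U. \<forall>u\<in>U. inner x u = L u"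
proof -
  define S where "S = (\<lambda>u. (u, - 2 * L u)) ` U"
  have "convex S"
    unfolding convex_alt
  proof (intro ballI allI impI)
    fix e e' t assume "e \<in> S" "e' \<in> S"
    then obtain u v where uv: "u \<in> U" "v \<in> U" "e = (u, - 2 * L u)" "e' = (v, - 2 * L v)"
      unfolding S_def by blast
    then have "(1 - t) *\<^sub>R u + t *\<^sub>R v \<in> U"
      "L ((1 - t) *\<^sub>R u + t *\<^sub>R v) = (1 - t) * L u + t * L v"
      using U(1) by (simp_all add: add scale subspace_add subspace_scale)
    then show "(1 - t) *\<^sub>R e + t *\<^sub>R e' \<in> S"
      unfolding S_def uv(3,4) by (auto intro!: image_eqI simp: algebra_simps)
  qed
  moreover have "S \<noteq> {}" using subspace_0[OF U(1)] by (auto simp: S_def)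
  moreover have "- (K\<^sup>2) \<le> (norm p)\<^sup>2 + s" if "(p, s) \<in> S" for p s
  proof -
    have "p \<in> U" "s = - 2 * L p" using that by (auto simp: S_def)
    with bound[of p] zero_le_power2[of "norm p - K"] show ?thesis
      by (simp add: power2_diff algebra_simps abs_le_iff)
  qed
  ultimately obtain x where x: "x \<in> closure (fst ` S)"
      "\<And>p s. (p, s) \<in> S \<Longrightarrow> - (K\<^sup>2) + (norm x)\<^sup>2 \<le> 2 * inner x p + s"
    using regularized_minimization[of S "- (K\<^sup>2)"] by metis
  have "fst ` S = U" by (auto simp: S_def image_image)
  with x(1) U(2) have "x \<in> U" by simp
  moreover have "inner x u = L u" if u: "u \<in> U" for u
  proof (rule ccontr)
    assume "inner x u \<noteq> L u"
    define c where "c = - (K\<^sup>2) + (norm x)\<^sup>2"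
    \<comment> \<open>A nonzero slope in \<open>t\<close> is incompatible with the lower bound
      \<open>c\<close>; this \<open>t\<close> makes the right-hand side equal to
      \<open>c - 1\<close>.\<close>
    define t where "t = (c - 1) / (2 * (inner x u - L u))"
    have "(t *\<^sub>R u, - 2 * L (t *\<^sub>R u)) \<in> S" using u U(1) by (auto simp: S_def subspace_scale)
    from x(2)[OF this] have "c \<le> t * (2 * (inner x u - L u))"
      unfolding c_def by (simp add: scale[OF u] algebra_simps)
    also have "\<dots> = c - 1" using \<open>inner x u \<noteq> L u\<close> unfolding t_def by simp
    finally show False by simp
  qed
  ultimately show ?thesis by blast
qed

text \<open>The projection of \<open>w\<close> represents the functional \<open><w, u>\<close>
  restricted to \<open>u\<close> in \<open>U\<close>.\<close>

lemma projection_exists: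
  fixes U :: "'a::{real_inner, complete_space} set"
  assumes "subspace U" "closed U"
  shows "\<exists>p\<in>U. \<forall>u\<in>U. orthogonal (w - p) u"
proof -
  have "\<exists>p\<in>U. \<forall>u\<in>U. inner p u = inner w u"
    by (rule Riesz_closed_subspace[OF assms, of _ "norm w"])
      (auto simp: inner_simps Cauchy_Schwarz_ineq2)
  then show ?thesis unfolding orthogonal_def inner_diff_left by (metis diff_self)
qed

section \<open>Weak convergence\<close>

text \<open>A diagonal subsequence makes the products with every member \<open>s m\<close> of the
  sequence converge. The vectors with convergent products form a closed subspace containing all
  \<open>s m\<close>. Riesz gives the limit on it, and projecting onto it treats the remaining test
  vectors, which covers nonseparable spaces as well.\<close>

lemma bounded_weakly_convergent_subsequence:
  fixes s :: "nat \<Rightarrow> 'a::{real_inner, complete_space}"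
  assumes bound: "\<And>n. norm (s n) \<le> K"
  obtains r l where "strict_mono (r :: nat \<Rightarrow> nat)" "weakly_tendsto (s \<circ> r) l"
proof -
  have K: "0 \<le> K" using bound[of 0] norm_ge_zero[of "s 0"] by linarith
  have ibound: "\<bar>inner (s n) u\<bar> \<le> K * norm u" for n u
    using Cauchy_Schwarz_ineq2[of "s n" u] bound[of n] mult_right_mono[of "norm (s n)" K "norm u"]
    by fastforce
  define P where "P = (\<lambda>m r. convergent (\<lambda>n. inner (s (r n)) (s m)))"
  interpret subseqs P
  proof
    fix m and r :: "nat \<Rightarrow> nat"
    have "\<forall>n. inner (s (r n)) (s m) \<in> {- (K * norm (s m)) .. K * norm (s m)}"
      using ibound[of "r _" "s m"] by (auto simp: abs_le_iff minus_le_iff)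
    then obtain l r' where "strict_mono r'" "((\<lambda>n. inner (s (r n)) (s m)) \<circ> r') \<longlonglongrightarrow> l"
      using compact_Icc compact_imp_seq_compact seq_compactE by metis
    then show "\<exists>r'. strict_mono r' \<and> P m (r \<circ> r')"
      by (auto simp: P_def convergent_def o_def)
  qed
  define r where "r = diagseq"
  have r: "strict_mono r" unfolding r_def by (rule subseq_diagseq)
  have conv: "convergent (\<lambda>n. inner (s (r n)) (s m))" for m
  proof -
    \<comment> \<open>\<open>diagseq\<close> is known to be a subsequence of the \<open>m\<close>-th
      selection only from index \<open>Suc m\<close> on, hence the shift.\<close>
    have "P m (diagseq \<circ> (+) (Suc m))"
    proof (rule diagseq_holds)
      fix r' t :: "nat \<Rightarrow> nat" and n
      assume "strict_mono r'" "P n t"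
      then show "P n (t \<circ> r')"
        using convergent_subseq_convergent[of "\<lambda>k. inner (s (t k)) (s n)" r']
        by (simp add: P_def o_def)
    qed
    then have "convergent (\<lambda>n. inner (s (r (n + Suc m))) (s m))"
      by (simp add: P_def r_def o_def add.commute)
    then show ?thesis
      using convergent_ignore_initial_segment[of "\<lambda>n. inner (s (r n)) (s m)" "Suc m"] by simp
  qed
  define U where "U = {u. convergent (\<lambda>n. inner (s (r n)) u)}"
  define L where "L = (\<lambda>u. lim (\<lambda>n. inner (s (r n)) u))"
  have L: "(\<lambda>n. inner (s (r n)) u) \<longlonglongrightarrow> L u" if "u \<in> U" for u
    using that by (simp add: U_def L_def convergent_LIMSEQ_iff)
  have Leq: "u \<in> U \<and> L u = l" if "(\<lambda>n. inner (s (r n)) u) \<longlonglongrightarrow> l" for u l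
    using that limI[OF that] by (auto simp: U_def L_def convergent_def)
  have add: "u + v \<in> U \<and> L (u + v) = L u + L v" if "u \<in> U" "v \<in> U" for u v
    using tendsto_add[OF L[OF that(1)] L[OF that(2)]] by (intro Leq) (simp add: inner_simps)
  have scale: "c *\<^sub>R u \<in> U \<and> L (c *\<^sub>R u) = c * L u" if "u \<in> U" for c u
    using tendsto_mult_left[OF L[OF that], of c] by (intro Leq) (simp add: inner_simps)
  have "subspace U"
    using add scale by (auto simp: subspace_def U_def convergent_const)
  have "closed U"
  proof -
    have "u \<in> U" if u: "u \<in> closure U" for u
    proof -
      have "Cauchy (\<lambda>n. inner (s (r n)) u)"
      proof (rule metric_CauchyI)
        fix \<epsilon> :: real assume e: "0 < \<epsilon>"
        \<comment> \<open>\<open>K + 1\<close> instead of \<open>K\<close> keeps the denominator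
          positive when \<open>K = 0\<close>.\<close>
        have "0 < \<epsilon> / (4 * (K + 1))" using e K by simp
        then obtain v where v: "v \<in> U" "dist v u < \<epsilon> / (4 * (K + 1))"
          using u unfolding closure_approachable by blast
        have "K * norm (u - v) \<le> (K + 1) * norm (u - v)" by (simp add: mult_right_mono)
        also have "\<dots> < \<epsilon> / 4"
          using v(2) K by (simp add: dist_norm norm_minus_commute field_simps)
        finally have small: "\<bar>inner (s n) (u - v)\<bar> < \<epsilon> / 4" for n
          using ibound[of n "u - v"] by simp
        have "Cauchy (\<lambda>n. inner (s (r n)) v)"
          using L[OF v(1)] by (rule LIMSEQ_imp_Cauchy)
        then obtain M where M: "\<And>i j. i \<ge> M \<Longrightarrow> j \<ge> M \<Longrightarrow>
            dist (inner (s (r i)) v) (inner (s (r j)) v) < \<epsilon> / 2"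
          using e unfolding Cauchy_def by (meson half_gt_zero)
        have "dist (inner (s (r i)) u) (inner (s (r j)) u) < \<epsilon>" if "i \<ge> M" "j \<ge> M" for i j
          using M[OF that] small[of "r i"] small[of "r j"]
          unfolding dist_real_def inner_diff_right by linarith
        then show "\<exists>M. \<forall>i\<ge>M. \<forall>j\<ge>M. dist (inner (s (r i)) u) (inner (s (r j)) u) < \<epsilon>"
          by blast
      qed
      then show ?thesis by (simp add: U_def Cauchy_convergent_iff)
    qed
    then show ?thesis using closure_subset_eq by blast
  qed
  have "\<bar>L u\<bar> \<le> K * norm u" if "u \<in> U" for u
    using tendsto_rabs[OF L[OF that]] ibound by (intro LIMSEQ_le_const2) auto
  with add scale obtain l where l: "l \<in> U" "\<And>u. u \<in> U \<Longrightarrow> inner l u = L u"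
    using Riesz_closed_subspace[OF \<open>subspace U\<close> \<open>closed U\<close>, of L K] by blast
  \<comment> \<open>All \<open>s m\<close> and \<open>l\<close> lie in \<open>U\<close>, so their
    products with \<open>u\<close> depend only on the projection \<open>p\<close> of
    \<open>u\<close>.\<close>
  have "(\<lambda>n. inner (s (r n)) u) \<longlonglongrightarrow> inner l u" for u
  proof -
    obtain p where p: "p \<in> U" "\<And>v. v \<in> U \<Longrightarrow> inner (u - p) v = 0"
      using projection_exists[OF \<open>subspace U\<close> \<open>closed U\<close>, of u] by (auto simp: orthogonal_def)
    have "s m \<in> U" for m using conv by (simp add: U_def)
    then have "inner (s m) u = inner (s m) p" for m
      using p(2)[of "s m"] by (simp add: inner_simps inner_commute)
    moreover have "inner l u = inner l p"
      using p(2)[OF l(1)] by (simp add: inner_simps inner_commute)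
    ultimately show ?thesis using L[OF p(1)] l(2)[OF p(1)] by simp
  qed
  with r show thesis by (intro that[of r l]) (auto simp: weakly_tendsto_def)
qed

text \<open>If convergence failed for one test vector, a subsequence would keep a fixed distance
  from the expected value, yet by boundedness it has a weakly convergent subsequence, whose limit
  must be \<open>l\<close>.\<close>

lemma bounded_weakly_tendstoI:
  fixes s :: "nat \<Rightarrow> 'a::{real_inner, complete_space}"
  assumes bound: "\<And>n. norm (s n) \<le> K"
    and cluster: "\<And>r p. strict_mono r \<Longrightarrow> weakly_tendsto (s \<circ> r) p \<Longrightarrow> p = l"
  shows "weakly_tendsto s l"
  unfolding weakly_tendsto_def
proof (rule allI, rule ccontr)
  fix u assume "\<not> (\<lambda>n. inner (s n) u) \<longlonglongrightarrow> inner l u"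
  then obtain \<epsilon> where e: "0 < \<epsilon>" "\<not> (\<forall>\<^sub>F n in sequentially. dist (inner (s n) u) (inner l u) < \<epsilon>)"
    unfolding tendsto_iff by blast
  obtain r :: "nat \<Rightarrow> nat" where r: "strict_mono r"
      "\<And>n. \<not> dist (inner (s (r n)) u) (inner l u) < \<epsilon>"
    using not_eventually_sequentiallyD[OF e(2)] by blast
  obtain r' p where r': "strict_mono (r' :: nat \<Rightarrow> nat)" "weakly_tendsto ((s \<circ> r) \<circ> r') p"
    using bounded_weakly_convergent_subsequence[of "s \<circ> r" K] bound by auto
  have "p = l" using r' r(1) by (intro cluster[of "r \<circ> r'"]) (auto simp: strict_mono_o o_assoc)
  with r'(2) have "(\<lambda>n. inner (s (r (r' n))) u) \<longlonglongrightarrow> inner l u"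
    by (simp add: weakly_tendsto_def)
  from tendstoD[OF this e(1)] r(2) show False by simp
qed

lemma weakly_tendsto_subseq:
  assumes "weakly_tendsto s p" "strict_mono r"
  shows "weakly_tendsto (s \<circ> r) p"
  using assms LIMSEQ_subseq_LIMSEQ unfolding weakly_tendsto_def o_def by fastforce

lemma weakly_tendsto_diff:
  assumes "weakly_tendsto s p" "weakly_tendsto t q"
  shows "weakly_tendsto (\<lambda>n. s n - t n) (p - q)"
  using assms unfolding weakly_tendsto_def by (auto simp: inner_diff_left intro!: tendsto_diff)

lemma weakly_tendsto_Suc:
  assumes "weakly_tendsto (\<lambda>n. s (Suc n)) p"
  shows "weakly_tendsto s p"
  using assms unfolding weakly_tendsto_def by (auto intro: LIMSEQ_imp_Suc)

lemma tendsto_imp_weakly_tendsto: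
  assumes "s \<longlonglongrightarrow> p"
  shows "weakly_tendsto s p"
  using assms unfolding weakly_tendsto_def by (auto intro!: tendsto_intros)

lemma tendsto_inner_null_bounded:
  fixes s t :: "nat \<Rightarrow> 'a::real_inner"
  assumes "s \<longlonglongrightarrow> 0" "\<And>n. norm (t n) \<le> K"
  shows "(\<lambda>n. inner (s n) (t n)) \<longlonglongrightarrow> 0"
proof (rule Lim_null_comparison)
  show "(\<lambda>n. norm (s n) * K) \<longlonglongrightarrow> 0"
    using tendsto_mult_right[OF tendsto_norm_zero[OF assms(1)], of K] by simp
  show "\<forall>\<^sub>F n in sequentially. norm (inner (s n) (t n)) \<le> norm (s n) * K"
    using Cauchy_Schwarz_ineq2 assms(2)
    by (auto intro!: always_eventually order_trans[OF Cauchy_Schwarz_ineq2] mult_left_mono)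
qed

text \<open>For two cluster points \<open>p\<close> and \<open>q\<close>, both in \<open>S\<close>,
  the distances of \<open>z n\<close> to \<open>p\<close> and to \<open>q\<close> converge. By
  polarization \<open><z n, p - q>\<close> converges too. Its limits along the two subsequences
  agree, so \<open><p - q, p - q> = 0\<close>.\<close>

lemma Opial:
  fixes z :: "nat \<Rightarrow> 'a::{real_inner, complete_space}"
  assumes "S \<noteq> {}"
    and fejer: "\<And>s n. s \<in> S \<Longrightarrow> norm (z (Suc n) - s) \<le> norm (z n - s)"
    and cluster: "\<And>r p. strict_mono r \<Longrightarrow> weakly_tendsto (z \<circ> r) p \<Longrightarrow> p \<in> S"
  obtains p where "p \<in> S" "weakly_tendsto z p"
proof -
  have decseq: "decseq (\<lambda>n. norm (z n - s))" if "s \<in> S" for s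
    using fejer[OF that] by (rule decseq_SucI)
  have conv: "convergent (\<lambda>n. norm (z n - s))" if "s \<in> S" for s
    using decseq_convergent[OF decseq[OF that], of 0] by (auto simp: convergent_def)
  obtain s where s: "s \<in> S" using \<open>S \<noteq> {}\<close> by blast
  have bound: "norm (z n) \<le> norm (z 0 - s) + norm s" for n
    using decseqD[OF decseq[OF s], of 0 n] norm_triangle_ineq[of "z n - s" s] by simp
  obtain r p where r: "strict_mono r" "weakly_tendsto (z \<circ> r) p"
    using bounded_weakly_convergent_subsequence[of z, OF bound] by blast
  have p: "p \<in> S" using cluster r by blast
  have "weakly_tendsto z p"
  proof (rule bounded_weakly_tendstoI[of z, OF bound])
    fix r' q assume r': "strict_mono r'" "weakly_tendsto (z \<circ> r') q"
    then have q: "q \<in> S" using cluster by blast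
    have eq: "inner (z n) (p - q)
        = ((norm (z n - q))\<^sup>2 - (norm (z n - p))\<^sup>2 + (norm p)\<^sup>2 - (norm q)\<^sup>2) / 2" for n
      by (simp add: power2_norm_eq_inner inner_simps inner_commute)
    obtain lp lq where "(\<lambda>n. norm (z n - p)) \<longlonglongrightarrow> lp" "(\<lambda>n. norm (z n - q)) \<longlonglongrightarrow> lq"
      using conv[OF p] conv[OF q] by (auto simp: convergent_def)
    then have l: "(\<lambda>n. inner (z n) (p - q)) \<longlonglongrightarrow> (lq\<^sup>2 - lp\<^sup>2 + (norm p)\<^sup>2 - (norm q)\<^sup>2) / 2"
      unfolding eq by (intro tendsto_intros) auto
    have "inner p (p - q) = inner q (p - q)"
      using LIMSEQ_unique[OF LIMSEQ_subseq_LIMSEQ[OF l r(1)]]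
        LIMSEQ_unique[OF LIMSEQ_subseq_LIMSEQ[OF l r'(1)]] r(2) r'(2)
      unfolding weakly_tendsto_def o_def by metis
    then have "inner (p - q) (p - q) = 0" by (simp add: inner_diff_left)
    then show "q = p" by simp
  qed
  with p show thesis by (rule that)
qed

section \<open>Maximal monotone operators\<close>

lemma maximal_monotoneD:
  assumes "maximal_monotone M" "u \<in> M x" "v \<in> M y"
  shows "0 \<le> inner (x - y) (u - v)"
  using assms unfolding maximal_monotone_def monotone_op_def by blast

text \<open>Adding \<open>(x, u)\<close> to the graph leaves it monotone, so by maximality the pair
  was there already.\<close>

lemma maximal_monotone_memI:
  assumes M: "maximal_monotone M"
    and pos: "\<And>a b. b \<in> M a \<Longrightarrow> 0 \<le> inner (x - a) (u - b)"
  shows "u \<in> M x"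
proof -
  define M' where "M' = M (x := insert u (M x))"
  have "monotone_op M'"
    unfolding monotone_op_def
  proof (intro allI ballI)
    fix a b v w assume "v \<in> M' a" "w \<in> M' b"
    then consider "v \<in> M a" "w \<in> M b" | "v \<in> M a" "b = x" "w = u"
      | "a = x" "v = u" "w \<in> M b" | "a = b" "v = w"
      by (auto simp: M'_def split: if_splits)
    then show "0 \<le> inner (a - b) (v - w)"
    proof cases
      case 2
      have "inner (a - b) (v - w) = inner (b - a) (w - v)" by (simp add: inner_simps)
      with pos[of v a] 2 show ?thesis by simp
    qed (use maximal_monotoneD[OF M] pos in simp_all)
  qed
  moreover have "\<forall>y. M y \<subseteq> M' y" by (auto simp: M'_def)
  ultimately have "M' = M" using M unfolding maximal_monotone_def by blast
  then have "M' x = M x" by simp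
  then show ?thesis by (auto simp: M'_def)
qed

lemma op_scale_memI: "u \<in> M x \<Longrightarrow> c *\<^sub>R u \<in> op_scale c M x"
  by (auto simp: op_scale_def)

lemma maximal_monotone_op_scale:
  assumes M: "maximal_monotone M" and "0 < c"
  shows "maximal_monotone (op_scale c M)"
  unfolding maximal_monotone_def
proof (intro conjI allI impI)
  show "monotone_op (op_scale c M)"
    unfolding monotone_op_def op_scale_def
  proof clarify
    fix a b u v assume "u \<in> M a" "v \<in> M b"
    with maximal_monotoneD[OF M] have "0 \<le> inner (a - b) (u - v)" by blast
    with \<open>0 < c\<close> have "0 \<le> c * inner (a - b) (u - v)" by simp
    then show "0 \<le> inner (a - b) (c *\<^sub>R u - c *\<^sub>R v)" by (simp add: inner_simps algebra_simps)
  qed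
  fix M' assume M': "monotone_op M' \<and> (\<forall>x. op_scale c M x \<subseteq> M' x)"
  have "M' x \<subseteq> op_scale c M x" for x
  proof
    fix u assume u: "u \<in> M' x"
    have "(1 / c) *\<^sub>R u \<in> M x"
    proof (rule maximal_monotone_memI[OF M])
      fix a b assume "b \<in> M a"
      then have "c *\<^sub>R b \<in> M' a" using M' op_scale_memI[of b M a c] by (meson subsetD)
      then have "0 \<le> inner (x - a) (u - c *\<^sub>R b)"
        using M' u unfolding monotone_op_def by meson
      moreover have "u - c *\<^sub>R b = c *\<^sub>R ((1 / c) *\<^sub>R u - b)"
        using \<open>0 < c\<close> by (simp add: scaleR_diff_right)
      ultimately show "0 \<le> inner (x - a) ((1 / c) *\<^sub>R u - b)"
        using \<open>0 < c\<close> by (simp add: zero_le_mult_iff)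
    qed
    from op_scale_memI[of "(1 / c) *\<^sub>R u" M x c, OF this] show "u \<in> op_scale c M x" using \<open>0 < c\<close> by simp
  qed
  with M' show "M' = op_scale c M" by (intro ext) blast
qed

text \<open>Monotonicity applied to two candidates \<open>p\<close> and \<open>q\<close> gives
  \<open>|p - q|^2 \<le> 0\<close>. The set behind \<open>the_elem\<close> is therefore a
  singleton.\<close>

lemma resolvent_eqI:
  assumes "maximal_monotone M" "w - p \<in> M p"
  shows "resolvent M w = p"
proof -
  have "op_inverse (op_plus (single_op id) M) w = {p}"
  proof (intro set_eqI iffI)
    fix q assume "q \<in> op_inverse (op_plus (single_op id) M) w"
    then have "w - q \<in> M q" by (auto simp: op_inverse_def op_plus_def single_op_def)
    from maximal_monotoneD[OF assms(1) assms(2) this] have "inner (p - q) (p - q) \<le> 0"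
      by (simp add: inner_simps inner_commute)
    then show "q \<in> {p}"
      by (metis eq_iff_diff_eq_0 inner_gt_zero_iff linorder_not_less singletonI)
  next
    fix q assume "q \<in> {p}"
    with assms(2) show "q \<in> op_inverse (op_plus (single_op id) M) w"
      by (auto simp: op_inverse_def op_plus_def single_op_def intro: exI[of _ "w - p"])
  qed
  then show ?thesis by (simp add: resolvent_def)
qed

text \<open>\<open>monotone_extension\<close> finds \<open>x\<close> such that
  \<open>(x, w - x)\<close> is monotonically related to the whole graph; maximality puts this pair
  into the graph.\<close>

theorem Minty:
  fixes M :: "'a::{real_inner, complete_space} \<Rightarrow> 'a set"
  assumes M: "maximal_monotone M"
  shows "\<exists>x. w - x \<in> M x"
proof -
  have "\<exists>x. \<forall>(a, b)\<in>{(a, b). b \<in> M a}. 0 \<le> inner (x - a) (w - x - b)"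
    using maximal_monotoneD[OF M] by (intro monotone_extension) auto
  then show ?thesis using maximal_monotone_memI[OF M] by blast
qed

lemma resolvent_mem:
  fixes M :: "'a::{real_inner, complete_space} \<Rightarrow> 'a set"
  assumes "maximal_monotone M"
  shows "w - resolvent M w \<in> M (resolvent M w)"
  using Minty[OF assms, of w] resolvent_eqI[OF assms] by auto

text \<open>
  Replaces maximality of \<open>A + D\<close>: for a Lipschitz constant below 1 it suffices to test
  against the resolvent of \<open>A\<close> at \<open>x + u - D x\<close>.
\<close>

lemma maximal_monotone_plus_Lipschitz_memI:
  fixes A :: "'a::{real_inner, complete_space} \<Rightarrow> 'a set"
  assumes A: "maximal_monotone A" and D: "L-lipschitz_on UNIV D" and "L < 1"
    and pos: "\<And>a b. b \<in> A a \<Longrightarrow> 0 \<le> inner (x - a) (u - (b + D a))"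
  shows "u - D x \<in> A x"
proof -
  define w where "w = x + u - D x"
  define p where "p = resolvent A w"
  have "w - p \<in> A p" unfolding p_def by (rule resolvent_mem[OF A])
  \<comment> \<open>With \<open>b = w - p\<close> and \<open>a = p\<close>, the second factor
    \<open>u - (b + D a)\<close> becomes \<open>(p - x) + (D x - D p)\<close>.\<close>
  from pos[OF this] have "inner (x - p) (x - p) \<le> inner (x - p) (D x - D p)"
    unfolding w_def by (simp add: inner_simps inner_commute)
  also have "\<dots> \<le> norm (x - p) * norm (D x - D p)" by (rule norm_cauchy_schwarz)
  also have "\<dots> \<le> norm (x - p) * (L * norm (x - p))"
    using lipschitz_onD[OF D, of x p] by (intro mult_left_mono) (auto simp: dist_norm)
  finally have "(1 - L) * (norm (x - p))\<^sup>2 \<le> 0"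
    by (simp add: power2_norm_eq_inner[symmetric] power2_eq_square algebra_simps)
  then have "p = x" using \<open>L < 1\<close> by (simp add: mult_le_0_iff)
  with \<open>w - p \<in> A p\<close> show ?thesis unfolding w_def by (simp add: algebra_simps)
qed

text \<open>Weak convergence does not control \<open><x n, u n>\<close> alone. But
  \<open><x, u> + <y, w> = <x - y, u> + <u + w, x> - <x - y, u + w>\<close>, where each product has
  a null factor and a bounded one. What remains is affine in \<open>x\<close> and \<open>u\<close>
  and passes to the weak limits.\<close>

lemma demiclosed_pairing:
  fixes x y u w :: "nat \<Rightarrow> 'a::real_inner"
  assumes x: "weakly_tendsto x x'" and u: "weakly_tendsto u u'"
    and xy: "(\<lambda>n. x n - y n) \<longlonglongrightarrow> 0" and uw: "(\<lambda>n. u n + w n) \<longlonglongrightarrow> 0"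
    and bx: "\<And>n. norm (x n) \<le> K" and bu: "\<And>n. norm (u n) \<le> K'"
    and m1: "\<And>n. 0 \<le> inner (x n - a) (u n - b)"
    and m2: "\<And>n. 0 \<le> inner (y n - c) (w n - d)"
  shows "0 \<le> inner (x' - a) (u' - b) + inner (x' - c) (- u' - d)"
proof -
  define e where "e = (\<lambda>n. inner (x n - y n) (u n) + inner (u n + w n) (x n)
      - inner (x n - y n) (u n + w n) + inner (x n - y n) d - inner c (u n + w n))"
  have "(\<lambda>n. inner (x n - y n) (u n + w n)) \<longlonglongrightarrow> 0"
    using tendsto_inner[OF xy uw] by simp
  then have "e \<longlonglongrightarrow> 0 + 0 - 0 + inner 0 d - inner c 0"
    unfolding e_def
    by (intro tendsto_intros tendsto_inner_null_bounded[OF xy bu]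
        tendsto_inner_null_bounded[OF uw bx] xy uw)
  then have "e \<longlonglongrightarrow> 0" by simp
  moreover have "(\<lambda>n. inner (u n) (c - a) + inner (x n) (- b - d) + inner a b + inner c d)
      \<longlonglongrightarrow> inner u' (c - a) + inner x' (- b - d) + inner a b + inner c d"
    using x u unfolding weakly_tendsto_def by (intro tendsto_add tendsto_const) auto
  ultimately have "(\<lambda>n. e n + (inner (u n) (c - a) + inner (x n) (- b - d) + inner a b + inner c d))
      \<longlonglongrightarrow> 0 + (inner u' (c - a) + inner x' (- b - d) + inner a b + inner c d)"
    by (rule tendsto_add)
  moreover have "e n + (inner (u n) (c - a) + inner (x n) (- b - d) + inner a b + inner c d)
      = inner (x n - a) (u n - b) + inner (y n - c) (w n - d)" for n
    unfolding e_def by (simp add: inner_simps inner_commute)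
  ultimately have "0 \<le> 0 + (inner u' (c - a) + inner x' (- b - d) + inner a b + inner c d)"
    using m1 m2 by (intro LIMSEQ_le_const) (auto intro: add_nonneg_nonneg)
  then show ?thesis by (simp add: inner_simps inner_commute)
qed

section \<open>Projection onto a subspace and its normal cone\<close>

lemma orth_proj_eqI:
  assumes V: "subspace V" and p: "p \<in> V" "\<And>v. v \<in> V \<Longrightarrow> orthogonal (x - p) v"
  shows "orth_proj V x = p"
  unfolding orth_proj_def
proof (rule the_equality)
  show "p \<in> V \<and> (\<forall>v\<in>V. orthogonal (x - p) v)" using p by blast
  fix q assume q: "q \<in> V \<and> (\<forall>v\<in>V. orthogonal (x - q) v)"
  then have "p - q \<in> V" using V p(1) by (simp add: subspace_diff)
  then have "inner (x - p) (p - q) = 0" "inner (x - q) (p - q) = 0"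
    using p(2) q by (auto simp: orthogonal_def)
  then have "inner (p - q) (p - q) = 0" by (simp add: inner_simps)
  then show "q = p" by simp
qed

lemma orth_proj_mem:
  fixes V :: "'a::{real_inner, complete_space} set"
  assumes "subspace V" "closed V"
  shows "orth_proj V x \<in> V"
  using projection_exists[OF assms, of x] orth_proj_eqI[OF assms(1)] by metis

text \<open>Testing the normal cone inequality at \<open>x + v\<close> and at \<open>x - v\<close>
  gives both signs.\<close>

lemma normal_cone_subspace_orthogonal:
  assumes V: "subspace V" and u: "u \<in> normal_cone V x" and v: "v \<in> V"
  shows "inner u v = 0"
proof -
  have x: "x \<in> V" and u: "\<And>z. z \<in> V \<Longrightarrow> inner u (z - x) \<le> 0"
    using u by (auto simp: normal_cone_def split: if_splits)
  from u[OF subspace_add[OF V x v]] u[OF subspace_diff[OF V x v]] show ?thesis by simp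
qed

section \<open>The splitting iteration\<close>

text \<open>The right-hand side minus the left is exactly twice the sum of the two assumed pairings.
  In the application \<open>z - x\<close> and \<open>q - p\<close> belong to \<open>B x\<close> and
  \<open>B p\<close>; their monotonicity is not spent here but kept in the last two terms, which the
  two cases treat differently.\<close>

lemma splitting_step_estimate:
  fixes x y z p q :: "'a::real_inner"
  assumes A: "0 \<le> inner (y - p) ((2 *\<^sub>R x - z - D x - y) - (p - q - D p))"
    and D: "0 \<le> inner (y - p) (D y - D p)"
  shows "(norm (z + y - x - (D y - D x) - q))\<^sup>2
    \<le> (norm (z - q))\<^sup>2 - (norm (x - y))\<^sup>2 + (norm (D y - D x))\<^sup>2
      - 2 * inner (x - p) ((z - x) - (q - p)) - 2 * inner (D y - D x) ((z - x) - (q - p))"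
    (is "?l \<le> ?r")
proof -
  have "0 \<le> 2 * (inner (y - p) ((2 *\<^sub>R x - z - D x - y) - (p - q - D p))
      + inner (y - p) (D y - D p))"
    using A D by simp
  also have "\<dots> = ?r - ?l"
    by (simp add: power2_norm_eq_inner inner_simps inner_commute algebra_simps)
  finally show ?thesis by (rule iffD1[OF diff_ge_0_iff_ge])
qed

text \<open>Monotonicity gives firm nonexpansiveness, \<open>|d|^2 \<le> <d, v - w>\<close>, and
  Cauchy-Schwarz does the rest.\<close>

lemma resolvent_norm_le:
  fixes M :: "'a::{real_inner, complete_space} \<Rightarrow> 'a set"
  assumes "maximal_monotone M"
  shows "norm (resolvent M v - resolvent M w) \<le> norm (v - w)"
proof -
  define d where "d = resolvent M v - resolvent M w"
  from maximal_monotoneD[OF assms resolvent_mem[OF assms, of v] resolvent_mem[OF assms, of w]]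
  have "norm d * norm d \<le> inner d (v - w)"
    unfolding d_def
    by (simp add: inner_simps inner_commute power2_norm_eq_inner flip: power2_eq_square)
  also have "\<dots> \<le> norm d * norm (v - w)" by (rule norm_cauchy_schwarz)
  finally show ?thesis unfolding d_def[symmetric]
    by (cases "norm d = 0") (auto simp: mult_le_cancel_left)
qed

text \<open>With \<open>b = q - p\<close> in \<open>B p\<close> and \<open>-b - D p\<close> in
  \<open>A p\<close>, the point \<open>p\<close> is a zero of \<open>A + B + D\<close>. The set
  collects \<open>q = p + b\<close> and not \<open>p\<close>, since it is with respect to
  \<open>q\<close> that \<open>z\<close> is Fejer monotone.\<close>

definition splitting_solutions ::
    "('a::real_inner \<Rightarrow> 'a set) \<Rightarrow> ('a \<Rightarrow> 'a set) \<Rightarrow> ('a \<Rightarrow> 'a) \<Rightarrow> 'a set" where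
  "splitting_solutions A B D = {q. \<exists>p. q - p \<in> B p \<and> p - q - D p \<in> A p}"

text \<open>The step size is absorbed into \<open>A\<close>, \<open>B\<close> and \<open>D\<close>.
  The assumption \<open>cross\<close> is the common interface of the two cases: \<open>k\<close> is
  the price of the cross term, and \<open>(1 + k) * L\<^sup>2 < 1\<close> says that the gain
  \<open>|x - y|^2\<close> pays for it.\<close>

lemma splitting_weak_convergence:
  fixes A B :: "'a::{real_inner, complete_space} \<Rightarrow> 'a set"
  assumes A: "maximal_monotone A" and B: "maximal_monotone B"
    and D: "\<And>a b. 0 \<le> inner (a - b) (D a - D b)"
    and lip: "L-lipschitz_on UNIV D" and k: "0 \<le> k" "(1 + k) * L\<^sup>2 < 1"
    and cross: "\<And>a b c u v. u \<in> B a \<Longrightarrow> v \<in> B b \<Longrightarrow>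
      0 \<le> 2 * inner (a - b) (u - v) + 2 * inner (D c - D a) (u - v) + k * (norm (D c - D a))\<^sup>2"
    and ne: "splitting_solutions A B D \<noteq> {}"
    and x: "\<And>n. x (Suc n) = resolvent B (z n)"
    and y: "\<And>n. y (Suc n) = resolvent A (2 *\<^sub>R x (Suc n) - z n - D (x (Suc n)))"
    and z: "\<And>n. z (Suc n) = z n + y (Suc n) - x (Suc n) - (D (y (Suc n)) - D (x (Suc n)))"
  obtains q where "q \<in> splitting_solutions A B D" "weakly_tendsto z q"
    "weakly_tendsto x (resolvent B q)" "weakly_tendsto y (resolvent B q)"
proof -
  define S where "S = splitting_solutions A B D"
  define \<epsilon> where "\<epsilon> = 1 - (1 + k) * L\<^sup>2"
  have "0 < \<epsilon>" using k(2) by (simp add: \<epsilon>_def)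
  have "1 * L\<^sup>2 \<le> (1 + k) * L\<^sup>2" using k(1) by (intro mult_right_mono) auto
  also have "\<dots> < 1" by (rule k(2))
  finally have "L < 1" by (intro power2_less_imp_less[of L 1]) auto
  have fejer: "(norm (z (Suc n) - q))\<^sup>2
      \<le> (norm (z n - q))\<^sup>2 - \<epsilon> * (norm (x (Suc n) - y (Suc n)))\<^sup>2" if q: "q \<in> S" for n q
  proof -
    obtain p where p: "q - p \<in> B p" "p - q - D p \<in> A p"
      using q unfolding S_def splitting_solutions_def by blast
    define X Y where "X = x (Suc n)" and "Y = y (Suc n)"
    have "z n - X \<in> B X" unfolding X_def x by (rule resolvent_mem[OF B])
    note cross = cross[OF this p(1), of Y]
    have "2 *\<^sub>R X - z n - D X - Y \<in> A Y" unfolding X_def Y_def y by (rule resolvent_mem[OF A])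
    \<comment> \<open>\<open>cross\<close> bounds the last two terms of the estimate by
      \<open>k * |D Y - D X|^2\<close>.\<close>
    from splitting_step_estimate[OF maximal_monotoneD[OF A this p(2)] D] cross
    have "(norm (z (Suc n) - q))\<^sup>2
        \<le> (norm (z n - q))\<^sup>2 - (norm (X - Y))\<^sup>2 + (1 + k) * (norm (D Y - D X))\<^sup>2"
      unfolding z X_def Y_def by (simp add: distrib_right)
    moreover have "(norm (D Y - D X))\<^sup>2 \<le> (L * norm (X - Y))\<^sup>2"
      using lipschitz_onD[OF lip, of Y X] by (intro power_mono) (auto simp: dist_norm norm_minus_commute)
    then have "(1 + k) * (norm (D Y - D X))\<^sup>2 \<le> (1 + k) * (L * norm (X - Y))\<^sup>2"
      using k(1) by (intro mult_left_mono) auto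
    ultimately show ?thesis
      unfolding \<epsilon>_def X_def Y_def by (simp add: power_mult_distrib algebra_simps)
  qed
  have dec: "norm (z (Suc n) - q) \<le> norm (z n - q)" if "q \<in> S" for n q
  proof (rule power2_le_imp_le)
    have "0 \<le> \<epsilon> * (norm (x (Suc n) - y (Suc n)))\<^sup>2" using \<open>0 < \<epsilon>\<close> by simp
    then show "(norm (z (Suc n) - q))\<^sup>2 \<le> (norm (z n - q))\<^sup>2"
      using fejer[OF that, of n] by linarith
  qed simp
  obtain s where s: "s \<in> S" using ne unfolding S_def by blast
  have decs: "decseq (\<lambda>n. norm (z n - s))" using dec[OF s] by (rule decseq_SucI)
  define R where "R = norm (z 0 - s)"
  have bz: "norm (z n - s) \<le> R" for n
    using decseqD[OF decs, of 0 n] by (simp add: R_def)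
  \<comment> \<open>The iteration leaves \<open>x 0\<close> and \<open>y 0\<close> arbitrary, so all
    bounds and limits are stated for \<open>Suc n\<close>.\<close>
  have bx: "norm (x (Suc n)) \<le> R + norm (resolvent B s)" for n
    using resolvent_norm_le[OF B, of "z n" s] bz[of n]
      norm_triangle_ineq[of "x (Suc n) - resolvent B s" "resolvent B s"] by (simp add: x)
  have bu: "norm (z n - x (Suc n)) \<le> 2 * R + norm s + norm (resolvent B s)" for n
    using norm_triangle_ineq4[of "z n" "x (Suc n)"] bx[of n] bz[of n]
      norm_triangle_ineq[of "z n - s" s] by simp

  have xy: "(\<lambda>n. x (Suc n) - y (Suc n)) \<longlonglongrightarrow> 0"
  proof -
    obtain l where "(\<lambda>n. norm (z n - s)) \<longlonglongrightarrow> l"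
      using decseq_convergent[OF decs, of 0] by auto
    then have l: "(\<lambda>n. (norm (z n - s))\<^sup>2) \<longlonglongrightarrow> l\<^sup>2" by (rule tendsto_power)
    have "(\<lambda>n. (norm (x (Suc n) - y (Suc n)))\<^sup>2) \<longlonglongrightarrow> 0"
    proof (rule Lim_null_comparison[OF always_eventually])
      show "(\<lambda>n. ((norm (z n - s))\<^sup>2 - (norm (z (Suc n) - s))\<^sup>2) / \<epsilon>) \<longlonglongrightarrow> 0"
        using tendsto_divide[OF tendsto_diff[OF l LIMSEQ_Suc[OF l]] tendsto_const[of \<epsilon>]] \<open>0 < \<epsilon>\<close>
        by simp
      show "\<forall>n. norm ((norm (x (Suc n) - y (Suc n)))\<^sup>2)
          \<le> ((norm (z n - s))\<^sup>2 - (norm (z (Suc n) - s))\<^sup>2) / \<epsilon>"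
      proof
        fix n
        show "norm ((norm (x (Suc n) - y (Suc n)))\<^sup>2)
          \<le> ((norm (z n - s))\<^sup>2 - (norm (z (Suc n) - s))\<^sup>2) / \<epsilon>"
          using fejer[OF s, of n] \<open>0 < \<epsilon>\<close> by (simp add: pos_le_divide_eq mult.commute)
      qed
    qed
    then have "(\<lambda>n. sqrt ((norm (x (Suc n) - y (Suc n)))\<^sup>2)) \<longlonglongrightarrow> sqrt 0"
      by (rule tendsto_real_sqrt)
    then show ?thesis by (simp add: tendsto_norm_zero_iff)
  qed
  have Dxy: "(\<lambda>n. D (y (Suc n)) - D (x (Suc n))) \<longlonglongrightarrow> 0"
  proof (rule Lim_null_comparison)
    show "(\<lambda>n. L * norm (x (Suc n) - y (Suc n))) \<longlonglongrightarrow> 0"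
      using tendsto_mult_left[OF tendsto_norm_zero[OF xy], of L] by simp
    show "\<forall>\<^sub>F n in sequentially.
        norm (D (y (Suc n)) - D (x (Suc n))) \<le> L * norm (x (Suc n) - y (Suc n))"
      using lipschitz_onD[OF lip] by (simp add: dist_norm norm_minus_commute)
  qed
  \<comment> \<open>The first summand is an element of \<open>B\<close> at \<open>x (Suc n)\<close>,
    the second one of \<open>A + D\<close> at \<open>y (Suc n)\<close>. Their sum collapses to
    \<open>x - y + (D y - D x)\<close>.\<close>
  have uw: "(\<lambda>n. (z n - x (Suc n))
      + ((2 *\<^sub>R x (Suc n) - z n - D (x (Suc n)) - y (Suc n)) + D (y (Suc n)))) \<longlonglongrightarrow> 0"
    using tendsto_add[OF xy Dxy] by (simp add: algebra_simps scaleR_2)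

  have graphs: "q - p \<in> B p \<and> p - q - D p \<in> A p"
    if r: "strict_mono r" and zr: "weakly_tendsto (z \<circ> r) q"
      and xr: "weakly_tendsto ((\<lambda>n. x (Suc n)) \<circ> r) p" for r p q
  proof -
    have pairing: "0 \<le> inner (p - a) ((q - p) - b) + inner (p - c) (- (q - p) - (d + D c))"
      if b: "b \<in> B a" and d: "d \<in> A c" for a b c d
    proof (rule demiclosed_pairing[where x = "\<lambda>n. x (Suc (r n))" and y = "\<lambda>n. y (Suc (r n))"
          and u = "\<lambda>n. z (r n) - x (Suc (r n))"
          and w = "\<lambda>n. (2 *\<^sub>R x (Suc (r n)) - z (r n) - D (x (Suc (r n))) - y (Suc (r n)))
            + D (y (Suc (r n)))"])
      show "weakly_tendsto (\<lambda>n. x (Suc (r n))) p" using xr by (simp add: o_def)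
      show "weakly_tendsto (\<lambda>n. z (r n) - x (Suc (r n))) (q - p)"
        using weakly_tendsto_diff[OF zr xr] by (simp add: o_def)
      show "(\<lambda>n. x (Suc (r n)) - y (Suc (r n))) \<longlonglongrightarrow> 0"
        using LIMSEQ_subseq_LIMSEQ[OF xy r] by (simp add: o_def)
      show "(\<lambda>n. (z (r n) - x (Suc (r n))) + ((2 *\<^sub>R x (Suc (r n)) - z (r n)
          - D (x (Suc (r n))) - y (Suc (r n))) + D (y (Suc (r n))))) \<longlonglongrightarrow> 0"
        using LIMSEQ_subseq_LIMSEQ[OF uw r] by (simp only: o_def)
      fix n
      show "norm (x (Suc (r n))) \<le> R + norm (resolvent B s)" by (rule bx)
      show "norm (z (r n) - x (Suc (r n))) \<le> 2 * R + norm s + norm (resolvent B s)" by (rule bu)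
      show "0 \<le> inner (x (Suc (r n)) - a) (z (r n) - x (Suc (r n)) - b)"
        unfolding x by (rule maximal_monotoneD[OF B resolvent_mem[OF B] b])
      define Y where "Y = y (Suc (r n))"
      define W where "W = 2 *\<^sub>R x (Suc (r n)) - z (r n) - D (x (Suc (r n)))"
      have "0 \<le> inner (Y - c) (W - Y - d)"
        unfolding Y_def W_def y by (rule maximal_monotoneD[OF A resolvent_mem[OF A] d])
      with D[of Y c] have "0 \<le> inner (Y - c) (W - Y + D Y - (d + D c))"
        by (simp add: inner_simps)
      then show "0 \<le> inner (y (Suc (r n)) - c) (2 *\<^sub>R x (Suc (r n)) - z (r n)
          - D (x (Suc (r n))) - y (Suc (r n)) + D (y (Suc (r n))) - (d + D c))"
        unfolding W_def Y_def .
    qed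
    \<comment> \<open>Otherwise some \<open>(a, b)\<close> makes the first summand of
      \<open>pairing\<close> negative, so the second is positive for all \<open>(c, d)\<close>. This
      forces \<open>-(q - p) - D p\<close> into \<open>A p\<close>, and taking it as
      \<open>d\<close> with \<open>c = p\<close> makes the second summand vanish, a contradiction.
      Afterwards \<open>a = p\<close>, \<open>b = q - p\<close> removes the first summand and
      settles \<open>A\<close>.\<close>
    have qB: "q - p \<in> B p"
    proof (rule ccontr)
      assume "q - p \<notin> B p"
      then obtain a b where b: "b \<in> B a" "inner (p - a) ((q - p) - b) < 0"
        using maximal_monotone_memI[OF B, of p "q - p"] by (meson not_le)
      have "- (q - p) - D p \<in> A p"
        using pairing[OF b(1)] b(2)
        by (intro maximal_monotone_plus_Lipschitz_memI[OF A lip \<open>L < 1\<close>]) fastforce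
      from pairing[OF b(1) this] b(2) show False by simp
    qed
    have "- (q - p) - D p \<in> A p"
      using pairing[OF qB] by (intro maximal_monotone_plus_Lipschitz_memI[OF A lip \<open>L < 1\<close>]) simp
    with qB show ?thesis by simp
  qed

  have "S \<noteq> {}" using s by blast
  then obtain q where q: "q \<in> S" "weakly_tendsto z q"
  proof (rule Opial)
    fix n and p assume "p \<in> S" then show "norm (z (Suc n) - p) \<le> norm (z n - p)" by (rule dec)
  next
    fix r q assume r: "strict_mono r" "weakly_tendsto (z \<circ> r) q"
    obtain r' p where r': "strict_mono r'" "weakly_tendsto (((\<lambda>n. x (Suc n)) \<circ> r) \<circ> r') p"
      using bounded_weakly_convergent_subsequence[of "(\<lambda>n. x (Suc n)) \<circ> r"] bx by (metis comp_def)
    have "weakly_tendsto (z \<circ> (r \<circ> r')) q"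
      using weakly_tendsto_subseq[OF r(2) r'(1)] by (simp add: o_assoc)
    moreover have "weakly_tendsto ((\<lambda>n. x (Suc n)) \<circ> (r \<circ> r')) p"
      using r'(2) by (simp add: o_assoc)
    ultimately have "q - p \<in> B p \<and> p - q - D p \<in> A p"
      using graphs strict_mono_o[OF r(1) r'(1)] by blast
    then show "q \<in> S" unfolding S_def splitting_solutions_def by blast
  qed
  \<comment> \<open>The resolvent need not be weakly continuous, so the limit is identified through
    cluster points: each \<open>p\<close> satisfies \<open>q - p \<in> B p\<close>.\<close>
  have xlim: "weakly_tendsto (\<lambda>n. x (Suc n)) (resolvent B q)"
  proof (rule bounded_weakly_tendstoI[of "\<lambda>n. x (Suc n)", OF bx])
    fix r p assume r: "strict_mono r" "weakly_tendsto ((\<lambda>n. x (Suc n)) \<circ> r) p"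
    then have "q - p \<in> B p" using graphs[OF r(1) weakly_tendsto_subseq[OF q(2) r(1)]] by blast
    then show "p = resolvent B q" using resolvent_eqI[OF B] by metis
  qed
  have ylim: "weakly_tendsto (\<lambda>n. y (Suc n)) (resolvent B q)"
    using weakly_tendsto_diff[OF xlim tendsto_imp_weakly_tendsto[OF xy]] by simp
  from q xlim ylim show thesis
    unfolding S_def by (rule that[OF _ _ weakly_tendsto_Suc weakly_tendsto_Suc])
qed

text \<open>At a solution both resolvents return the same \<open>p\<close>, so the two
  \<open>F\<close> terms of \<open>splitting_op\<close> cancel. Adding the two inclusions and
  dividing by \<open>\<gamma>\<close> gives the zero.\<close>

lemma splitting_solutions_fixed:
  fixes A B :: "'a::{real_inner, complete_space} \<Rightarrow> 'a set"
  assumes A: "maximal_monotone A" and B: "maximal_monotone B" and "0 < \<gamma>"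
    and q: "q \<in> splitting_solutions (op_scale \<gamma> A) (op_scale \<gamma> B) (\<lambda>w. \<gamma> *\<^sub>R C w)"
  shows "q \<in> Fix (splitting_op \<gamma> A B C)"
    and "resolvent (op_scale \<gamma> B) q \<in> zer (op_plus (op_plus A B) (single_op C))"
proof -
  obtain p where p: "q - p \<in> op_scale \<gamma> B p" "p - q - \<gamma> *\<^sub>R C p \<in> op_scale \<gamma> A p"
    using q unfolding splitting_solutions_def by blast
  have JB: "resolvent (op_scale \<gamma> B) q = p"
    using p(1) by (intro resolvent_eqI maximal_monotone_op_scale B \<open>0 < \<gamma>\<close>)
  have JA: "resolvent (op_scale \<gamma> A) (2 *\<^sub>R p - q - \<gamma> *\<^sub>R C p) = p"
    using p(2)
    by (intro resolvent_eqI maximal_monotone_op_scale A \<open>0 < \<gamma>\<close>) (simp add: algebra_simps scaleR_2)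
  show "q \<in> Fix (splitting_op \<gamma> A B C)"
    by (simp add: Fix_def splitting_op_def Let_def JA JB)
  obtain b where b: "b \<in> B p" "q - p = \<gamma> *\<^sub>R b" using p(1) by (auto simp: op_scale_def)
  obtain a where a: "a \<in> A p" "p - q - \<gamma> *\<^sub>R C p = \<gamma> *\<^sub>R a" using p(2) by (auto simp: op_scale_def)
  have "\<gamma> *\<^sub>R (a + b + C p) = 0"
    using a(2) b(2) by (simp add: scaleR_add_right flip: a(2) b(2))
  then have "0 = a + b + C p" using \<open>0 < \<gamma>\<close> by simp
  then show "resolvent (op_scale \<gamma> B) q \<in> zer (op_plus (op_plus A B) (single_op C))"
    unfolding JB zer_def op_plus_def single_op_def using a(1) b(1) by blast
qed

lemma splitting_solutions_nonempty:
  assumes "zer (op_plus (op_plus A B) (single_op C)) \<noteq> {}"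
  shows "splitting_solutions (op_scale \<gamma> A) (op_scale \<gamma> B) (\<lambda>w. \<gamma> *\<^sub>R C w) \<noteq> {}"
proof -
  obtain p a b where p: "a \<in> A p" "b \<in> B p" "0 = a + b + C p"
    using assms unfolding zer_def op_plus_def single_op_def by blast
  have "a = - b - C p" using p(3) by (simp add: algebra_simps eq_neg_iff_add_eq_0)
  then have "- (\<gamma> *\<^sub>R b) - \<gamma> *\<^sub>R C p = \<gamma> *\<^sub>R a" by (simp add: scaleR_diff_right)
  then have "p + \<gamma> *\<^sub>R b \<in> splitting_solutions (op_scale \<gamma> A) (op_scale \<gamma> B) (\<lambda>w. \<gamma> *\<^sub>R C w)"
    using op_scale_memI[of a A p \<gamma>, OF p(1)] op_scale_memI[of b B p \<gamma>, OF p(2)]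
    unfolding splitting_solutions_def by (auto intro!: exI[of _ p])
  then show ?thesis by blast
qed

section \<open>Step sizes and the cross term in the two cases\<close>

text \<open>\<open>\<gamma> < \<kappa>\<close> bounds the radicand by \<open>3 / 2\<close>, whose
  root is the reciprocal of \<open>sqrt (2 / 3)\<close>.\<close>

lemma stepsize_bound_sqrt:
  assumes "0 < \<mu>" "0 < \<gamma>" "0 < \<kappa>" "\<gamma> < min \<kappa> (inverse \<mu> * sqrt (2 / 3))"
  shows "\<gamma> < inverse \<mu> / sqrt (1 + \<gamma> / (2 * \<kappa>))"
proof -
  have "1 + \<gamma> / (2 * \<kappa>) \<le> 3 / 2" using assms by (simp add: field_simps)
  then have "sqrt (1 + \<gamma> / (2 * \<kappa>)) \<le> sqrt (3 / 2)" by simp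
  then have "inverse (sqrt (3 / 2)) \<le> inverse (sqrt (1 + \<gamma> / (2 * \<kappa>)))"
    using assms by (intro le_imp_inverse_le) (auto intro!: add_pos_pos)
  also have "inverse (sqrt (3 / 2)) = sqrt (2 / 3)" by (simp flip: real_sqrt_inverse)
  finally have "sqrt (2 / 3) \<le> inverse (sqrt (1 + \<gamma> / (2 * \<kappa>)))" .
  then have "inverse \<mu> * sqrt (2 / 3) \<le> inverse \<mu> * inverse (sqrt (1 + \<gamma> / (2 * \<kappa>)))"
    using \<open>0 < \<mu>\<close> by (intro mult_left_mono) auto
  also have "\<dots> = inverse \<mu> / sqrt (1 + \<gamma> / (2 * \<kappa>))" by (rule divide_inverse[symmetric])
  finally show ?thesis using assms(4) by simp
qed

lemma stepsize_bound_square: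
  assumes "0 < \<mu>" "0 < \<gamma>" "0 \<le> k" "\<gamma> < inverse \<mu> / sqrt (1 + k)"
  shows "(1 + k) * (\<gamma> * \<mu>)\<^sup>2 < 1"
proof -
  have "sqrt (1 + k) * (\<gamma> * \<mu>) < 1"
    using assms by (simp add: field_simps)
  then have "(sqrt (1 + k) * (\<gamma> * \<mu>))\<^sup>2 < 1"
    using assms by (simp add: power_less_one_iff abs_square_less_1)
  then show ?thesis using assms by (simp add: power_mult_distrib)
qed

text \<open>With \<open>e = b x - b y\<close>, cocoercivity reduces the claim to a complete square,
  \<open>\<gamma> / (2 * \<kappa>)\<close> times \<open>|d + 2 \<kappa> e|^2\<close>. This is where
  the constant in the step size condition comes from.\<close>

lemma cocoercive_cross_term:
  assumes b: "cocoercive \<kappa> b" and "0 < \<kappa>" "0 < \<gamma>"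
    and u: "u \<in> op_scale \<gamma> (single_op b) x" and v: "v \<in> op_scale \<gamma> (single_op b) y"
  shows "0 \<le> 2 * inner (x - y) (u - v) + 2 * inner d (u - v) + \<gamma> / (2 * \<kappa>) * (norm d)\<^sup>2"
proof -
  have uv: "u - v = \<gamma> *\<^sub>R (b x - b y)"
    using u v by (simp add: op_scale_def single_op_def scaleR_diff_right)
  define e where "e = b x - b y"
  have square: "(norm (d + (2 * \<kappa>) *\<^sub>R e))\<^sup>2
      = (norm d)\<^sup>2 + 4 * \<kappa> * inner d e + 4 * \<kappa>\<^sup>2 * (norm e)\<^sup>2"
    unfolding power2_norm_eq_inner
    by (simp add: inner_simps inner_commute algebra_simps power2_eq_square)
  have "\<kappa> * (norm e)\<^sup>2 \<le> inner (x - y) e" using b unfolding cocoercive_def e_def by simp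
  then have "\<gamma> * (\<kappa> * (norm e)\<^sup>2) \<le> \<gamma> * inner (x - y) e"
    using \<open>0 < \<gamma>\<close> by (intro mult_left_mono) auto
  moreover have "2 * (\<gamma> * (\<kappa> * (norm e)\<^sup>2)) + 2 * (\<gamma> * inner d e) + \<gamma> / (2 * \<kappa>) * (norm d)\<^sup>2
      = \<gamma> / (2 * \<kappa>) * (norm (d + (2 * \<kappa>) *\<^sub>R e))\<^sup>2"
    using \<open>0 < \<kappa>\<close> unfolding square by (simp add: field_simps power2_eq_square)
  moreover have "0 \<le> \<gamma> / (2 * \<kappa>) * (norm (d + (2 * \<kappa>) *\<^sub>R e))\<^sup>2"
    using \<open>0 < \<kappa>\<close> \<open>0 < \<gamma>\<close> by simp
  ultimately show ?thesis unfolding uv e_def[symmetric] by simp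
qed

text \<open>Both products vanish: \<open>x - y\<close> and \<open>d\<close> lie in \<open>V\<close>,
  while \<open>u\<close> and \<open>v\<close> are orthogonal to \<open>V\<close>.\<close>

lemma normal_cone_cross_term:
  fixes V :: "'a::real_inner set"
  assumes V: "subspace V"
    and u: "u \<in> op_scale \<gamma> (normal_cone V) x" and v: "v \<in> op_scale \<gamma> (normal_cone V) y"
    and d: "d \<in> V"
  shows "0 \<le> 2 * inner (x - y) (u - v) + 2 * inner d (u - v)"
proof -
  have orth: "inner t w = 0" if "w \<in> op_scale \<gamma> (normal_cone V) s" "t \<in> V" for s t w
    using that normal_cone_subspace_orthogonal[OF V, of _ s t]
    by (auto simp: op_scale_def inner_commute)
  have "x \<in> V" "y \<in> V"
    using u v by (auto simp: op_scale_def normal_cone_def split: if_splits)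
  then show ?thesis
    using orth[OF u] orth[OF v] V d by (simp add: inner_diff_right subspace_diff)
qed

theorem theorem4p1:
  fixes A B :: "'a::{real_inner, complete_space} \<Rightarrow> 'a set"
    and C :: "'a \<Rightarrow> 'a"
    and \<mu> \<gamma> :: real
    and x y z :: "nat \<Rightarrow> 'a"
  assumes "0 < \<mu>"
    and "maximal_monotone A"
    and "maximal_monotone B"
    and "monotone_op (single_op C)"
    and "\<mu>-lipschitz_on UNIV C"
    and "zer (op_plus (op_plus A B) (single_op C)) \<noteq> {}"
    and "0 < \<gamma>"
    and "\<And>n. x (Suc n) = resolvent (op_scale \<gamma> B) (z n)"
    and "\<And>n. y (Suc n) =
           resolvent (op_scale \<gamma> A) (2 *\<^sub>R x (Suc n) - z n - \<gamma> *\<^sub>R C (x (Suc n)))"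
    and "\<And>n. z (Suc n) =
           z n + y (Suc n) - x (Suc n) - \<gamma> *\<^sub>R (C (y (Suc n)) - C (x (Suc n)))"
  shows "(\<forall>\<kappa>>0. \<gamma> < min \<kappa> (inverse \<mu> * sqrt (2 / 3)) \<longrightarrow>
             \<gamma> < inverse \<mu> / sqrt (1 + \<gamma> / (2 * \<kappa>))) \<and>
         ((\<exists>b \<kappa>. B = single_op b \<and> 0 < \<kappa> \<and> cocoercive \<kappa> b \<and>
                 \<gamma> < inverse \<mu> / sqrt (1 + \<gamma> / (2 * \<kappa>))) \<or>
          (\<exists>V C1. subspace V \<and> closed V \<and> B = normal_cone V \<and>
                 C = orth_proj V \<circ> C1 \<circ> orth_proj V \<and> \<gamma> < 1 / \<mu>)
          \<longrightarrow>
          (\<exists>z_star \<in> Fix (splitting_op \<gamma> A B C).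
             weakly_tendsto z z_star \<and>
             weakly_tendsto x (resolvent (op_scale \<gamma> B) z_star) \<and>
             resolvent (op_scale \<gamma> B) z_star
               \<in> zer (op_plus (op_plus A B) (single_op C)) \<and>
             weakly_tendsto y (resolvent (op_scale \<gamma> B) z_star)))"
proof (intro conjI allI impI)
  fix \<kappa> :: real
  assume "0 < \<kappa>" "\<gamma> < min \<kappa> (inverse \<mu> * sqrt (2 / 3))"
  then show "\<gamma> < inverse \<mu> / sqrt (1 + \<gamma> / (2 * \<kappa>))"
    by (rule stepsize_bound_sqrt[OF assms(1,7)])
next
  assume cases: "(\<exists>b \<kappa>. B = single_op b \<and> 0 < \<kappa> \<and> cocoercive \<kappa> b \<and>
        \<gamma> < inverse \<mu> / sqrt (1 + \<gamma> / (2 * \<kappa>))) \<or>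
      (\<exists>V C1. subspace V \<and> closed V \<and> B = normal_cone V \<and>
        C = orth_proj V \<circ> C1 \<circ> orth_proj V \<and> \<gamma> < 1 / \<mu>)"
  define D where "D = (\<lambda>w. \<gamma> *\<^sub>R C w)"
  \<comment> \<open>\<open>k\<close> is \<open>\<gamma> / (2 * \<kappa>)\<close> in case (i) and 0
    in case (ii).\<close>
  obtain k where k: "0 \<le> k" "(1 + k) * (\<gamma> * \<mu>)\<^sup>2 < 1"
    and cross: "\<And>a b c u v. u \<in> op_scale \<gamma> B a \<Longrightarrow> v \<in> op_scale \<gamma> B b \<Longrightarrow>
      0 \<le> 2 * inner (a - b) (u - v) + 2 * inner (D c - D a) (u - v) + k * (norm (D c - D a))\<^sup>2"
    using cases
  proof (elim disjE exE conjE)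
    fix b \<kappa>
    assume i: "B = single_op b" "0 < \<kappa>" "cocoercive \<kappa> b" "\<gamma> < inverse \<mu> / sqrt (1 + \<gamma> / (2 * \<kappa>))"
    show thesis
    proof (rule that)
      show nonneg: "0 \<le> \<gamma> / (2 * \<kappa>)" using assms(7) i(2) by simp
      show "(1 + \<gamma> / (2 * \<kappa>)) * (\<gamma> * \<mu>)\<^sup>2 < 1"
        by (rule stepsize_bound_square[OF assms(1,7) nonneg i(4)])
    qed (use cocoercive_cross_term[OF i(3,2) assms(7)] i(1) in blast)
  next
    fix V C1
    assume ii: "subspace V" "closed V" "B = normal_cone V"
      "C = orth_proj V \<circ> C1 \<circ> orth_proj V" "\<gamma> < 1 / \<mu>"
    \<comment> \<open>The outer projection in \<open>C\<close> puts every value of \<open>D\<close>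
      into \<open>V\<close>, which makes the cross term vanish.\<close>
    have "D a \<in> V" for a
      unfolding D_def ii(4) using ii(1,2) by (simp add: orth_proj_mem subspace_scale)
    then have "D c - D a \<in> V" for a c using ii(1) by (simp add: subspace_diff)
    with normal_cone_cross_term[OF ii(1)]
    have "0 \<le> 2 * inner (a - b) (u - v) + 2 * inner (D c - D a) (u - v) + 0 * (norm (D c - D a))\<^sup>2"
      if "u \<in> op_scale \<gamma> B a" "v \<in> op_scale \<gamma> B b" for a b c u v
      using that unfolding ii(3) by simp
    moreover have "(1 + 0) * (\<gamma> * \<mu>)\<^sup>2 < 1"
      using ii(5) by (intro stepsize_bound_square[OF assms(1,7)]) (auto simp: divide_inverse)
    ultimately show thesis using that[of 0] by blast
  qed
  have lip: "(\<gamma> * \<mu>)-lipschitz_on UNIV D"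
    using lipschitz_on_cmult[OF assms(5), of \<gamma>] assms(7) unfolding D_def by simp
  have mono: "0 \<le> inner (a - b) (D a - D b)" for a b
    using assms(4,7) unfolding monotone_op_def single_op_def D_def
    by (simp flip: scaleR_diff_right)
  have ne: "splitting_solutions (op_scale \<gamma> A) (op_scale \<gamma> B) D \<noteq> {}"
    unfolding D_def by (rule splitting_solutions_nonempty[OF assms(6)])
  have y: "y (Suc n) = resolvent (op_scale \<gamma> A) (2 *\<^sub>R x (Suc n) - z n - D (x (Suc n)))"
    and z: "z (Suc n) = z n + y (Suc n) - x (Suc n) - (D (y (Suc n)) - D (x (Suc n)))" for n
    using assms(9,10)[of n] by (simp_all add: D_def scaleR_diff_right)
  obtain q where q: "q \<in> splitting_solutions (op_scale \<gamma> A) (op_scale \<gamma> B) D"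
      "weakly_tendsto z q" "weakly_tendsto x (resolvent (op_scale \<gamma> B) q)"
      "weakly_tendsto y (resolvent (op_scale \<gamma> B) q)"
    by (rule splitting_weak_convergence[where x = x and y = y and z = z and D = D,
          OF maximal_monotone_op_scale[OF assms(2,7)] maximal_monotone_op_scale[OF assms(3,7)]
            mono lip k cross ne assms(8) y z])
  then show "\<exists>z_star \<in> Fix (splitting_op \<gamma> A B C).
      weakly_tendsto z z_star \<and>
      weakly_tendsto x (resolvent (op_scale \<gamma> B) z_star) \<and>
      resolvent (op_scale \<gamma> B) z_star \<in> zer (op_plus (op_plus A B) (single_op C)) \<and>
      weakly_tendsto y (resolvent (op_scale \<gamma> B) z_star)"
    using splitting_solutions_fixed[OF assms(2,3,7)] unfolding D_def by blast
qed

end
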